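(* Let $k$ be a positive integer and let $A,B$ be two distinct faulty nodes of the dense Gaussian network $G_k$. The shifted direct new-source selection algorithm (described in the context), run on input $(k,A,B)$, examines at most $9\times16=144$ algebraic cases (a case being a pair consisting of a lattice shift and a sign tuple), each using a constant number of arithmetic operations. Consequently, under the standard word-RAM model, where arithmetic on node coordinates is treated as constant time, the algorithm runs in $O(1)$ time, independent of $k$ and of the number of nodes $N=k^2+(k+1)^2$.
   Context: Dense Gaussian network: for a positive integer $k$, $G_k$ is the graph whose nodes are the elements of $\mathbb Z[i]/(k+(k+1)i)$, equivalently $\mathbb Z^2$ modulo the lattice generated by $e_1=(k,k+1)$ and $e_2=(-(k+1),k)$, where $(x,y)$ stands for $x+yi$; two nodes are adjacent iff they differ by $\pm1$ or $\pm i$. It has $N=k^2+(k+1)^2$ nodes and diameter $k$. Let $D_k=\{(x,y)\in\mathbb Z^2:|x|+|y|\le k\}$; every node has a unique canonical representative in $D_k$ (the equivalent representative of minimum Manhattan length), and $\operatorname{mod}_{G_k}(\cdot)$ denotes reduction to it. $d$ denotes graph distance in $G_k$; $d(U,V)=|x|+|y|$ where $(x,y)=\operatorname{mod}_{G_k}(U-V)$. A valid new source for $A,B$ is a node $NS$ with $d(NS,A)=d(NS,B)=k$. Shifted direct new-source selection algorithm. Input: $k$ and $A,B\in G_k$. 1. Set $C=(c,d)=\operatorname{mod}_{G_k}(B-A)\in D_k$. 2. For every $(m,n)\in\{-1,0,1\}^2$: let $(L_x,L_y)=m e_1+n e_2$, $c'=c+L_x$, $d'=d+L_y$. For every sign tuple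 $(s_1,s_2,s_3,s_4)\in\{\pm1\}^4$: let $M=k+s_3c'+s_4d'$ and $D=s_1s_4-s_2s_3$. (a) If $D\neq0$: let $p=(ks_4-s_2M)/D$ and $q=(s_1M-ks_3)/D$. If $p,q$ are integers, $|p|+|q|=k$ and $|p-c'|+|q-d'|=k$, put $NS=\operatorname{mod}_{G_k}(A+(p,q))$; if $d(NS,A)=k$ and $d(NS,B)=k$, return $NS$ and stop. (b) If $D=0$ (parallel case): candidates are $(p,q)=(s_1t,\,s_2(k-t))$ with $t$ an integer. If $(s_3,s_4)=(s_1,s_2)$ and $M=k$, the interval is $\max(0,s_1c')\le t\le\min(k,k-s_2d')$. If $(s_3,s_4)=(-s_1,-s_2)$ and $M=-k$, the interval is $\max(0,k-s_2d')\le t\le\min(k,s_1c')$. Otherwise there is no candidate. If the interval is nonempty, take $t$ to be an endpoint of it; if the resulting $(p,q)$ is verified to satisfy the two distance conditions $d((p,q),0)=k$ and $d((p,q),C)=k$, return $NS=\operatorname{mod}_{G_k}(A+(p,q))$ and stop. The loops over $(m,n)$ and over sign tuples may be run in any fixed order. *)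

theory Defs
  imports Complex_Main "HOL-Library.Monad_Syntax" "HOL-Library.Product_Plus"
begin

section \<open>Dense Gaussian networks\<close>

text \<open>A point \<open>(x, y)\<close> stands for \<open>x + y i\<close>. The nodes of \<open>G\<^sub>k\<close> are represented by their
  canonical representatives, i.e. by the elements of \<^term>\<open>disc k\<close>.\<close>

type_synonym point = "int \<times> int"

definition manhattan :: "point \<Rightarrow> int" where
  "manhattan z = \<bar>fst z\<bar> + \<bar>snd z\<bar>"

definition disc :: "int \<Rightarrow> point set" where
  "disc k = {z. manhattan z \<le> k}"

definition num_nodes :: "int \<Rightarrow> int" where
  "num_nodes k = k^2 + (k + 1)^2"

definition lattice_vec :: "int \<Rightarrow> int \<Rightarrow> int \<Rightarrow> point" where
  "lattice_vec k m n = (m * k - n * (k + 1), m * (k + 1) + n * k)"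

definition same_node :: "int \<Rightarrow> point \<Rightarrow> point \<Rightarrow> bool" where
  "same_node k z z' \<longleftrightarrow> (\<exists>m n. z - z' = lattice_vec k m n)"

definition gmod :: "int \<Rightarrow> point \<Rightarrow> point" where
  "gmod k z = (THE z'. z' \<in> disc k \<and> same_node k z z')"

definition gdist :: "int \<Rightarrow> point \<Rightarrow> point \<Rightarrow> int" where
  "gdist k U V = manhattan (gmod k (U - V))"

section \<open>The shifted direct selection algorithm\<close>

type_synonym case_id = "(int \<times> int) \<times> (int \<times> int \<times> int \<times> int)"

definition all_cases :: "case_id set" where
  "all_cases = ({-1, 0, 1} \<times> {-1, 0, 1}) \<times> ({-1, 1} \<times> {-1, 1} \<times> {-1, 1} \<times> {-1, 1})"

text \<open>\<open>low\<close> tells, in a parallel case, which endpoint of the interval is taken.\<close>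

fun case_result ::
  "int \<Rightarrow> point \<Rightarrow> point \<Rightarrow> point \<Rightarrow> (case_id \<Rightarrow> bool) \<Rightarrow> case_id \<Rightarrow> point option" where
  "case_result k A B C low ((m, n), (s1, s2, s3, s4)) =
    (let c' = fst C + fst (lattice_vec k m n);
         d' = snd C + snd (lattice_vec k m n);
         M = k + s3 * c' + s4 * d';
         D = s1 * s4 - s2 * s3
     in if D \<noteq> 0 then
          let p = real_of_int (k * s4 - s2 * M) / real_of_int D;
              q = real_of_int (s1 * M - k * s3) / real_of_int D
          in if p \<in> \<int> \<and> q \<in> \<int> \<and> \<bar>p\<bar> + \<bar>q\<bar> = k \<and> \<bar>p - c'\<bar> + \<bar>q - d'\<bar> = k then
               let NS = gmod k (A + (\<lfloor>p\<rfloor>, \<lfloor>q\<rfloor>))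
               in if gdist k NS A = k \<and> gdist k NS B = k then Some NS else None
             else None
        else
          let interval =
            (if (s3, s4) = (s1, s2) \<and> M = k
               then Some (max 0 (s1 * c'), min k (k - s2 * d'))
             else if (s3, s4) = (- s1, - s2) \<and> M = - k
               then Some (max 0 (k - s2 * d'), min k (s1 * c'))
             else None)
          in case interval of
               None \<Rightarrow> None
             | Some (l, h) \<Rightarrow>
                 if l \<le> h then
                   let t = (if low ((m, n), (s1, s2, s3, s4)) then l else h);
                       z = (s1 * t, s2 * (k - t))
                   in if gdist k z 0 = k \<and> gdist k z C = k then Some (gmod k (A + z)) else None
                 else None)"

primrec first_result :: "('c \<Rightarrow> 'b option) \<Rightarrow> 'c list \<Rightarrow> 'b option" where
  "first_result f [] = None"
| "first_result f (x # xs) = (case f x of None \<Rightarrow> first_result f xs | Some y \<Rightarrow> Some y)"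

text \<open>\<open>cs\<close> is the order in which the cases are tried.\<close>

definition select_source ::
  "(case_id \<Rightarrow> bool) \<Rightarrow> case_id list \<Rightarrow> int \<Rightarrow> point \<Rightarrow> point \<Rightarrow> point option" where
  "select_source low cs k A B = first_result (case_result k A B (gmod k (B - A)) low) cs"

section \<open>Word RAM\<close>

text \<open>A computation takes the word size \<open>w\<close>. It fails on overflow (a word holds a sign and \<open>w\<close>
  bits) or division by zero, and otherwise returns a value and the number of executed
  instructions. The type of register contents carries no arithmetic, so programs that use neither
  its constructor nor its selector can only compute by means of the instructions below, each of
  which is charged one unit.\<close>

datatype reg = Reg (reg_val: int)

type_synonym rpoint = "reg \<times> reg"

type_synonym 'a ram = "nat \<Rightarrow> ('a \<times> nat) option"

definition ret :: "'a \<Rightarrow> 'a ram" where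
  "ret x = (\<lambda>w. Some (x, 0))"

definition ram_bind :: "'a ram \<Rightarrow> ('a \<Rightarrow> 'b ram) \<Rightarrow> 'b ram" where
  "ram_bind p f = (\<lambda>w. case p w of
     None \<Rightarrow> None
   | Some (x, t) \<Rightarrow> (case f x w of None \<Rightarrow> None | Some (y, t') \<Rightarrow> Some (y, t + t')))"

adhoc_overloading Monad_Syntax.bind \<rightleftharpoons> ram_bind

definition result :: "int \<Rightarrow> reg ram" where
  "result v = (\<lambda>w. if \<bar>v\<bar> < 2 ^ w then Some (Reg v, 1) else None)"

definition load :: "int \<Rightarrow> reg ram" where
  "load v = result v"

definition add :: "reg \<Rightarrow> reg \<Rightarrow> reg ram" where
  "add a b = result (reg_val a + reg_val b)"

definition sub :: "reg \<Rightarrow> reg \<Rightarrow> reg ram" where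
  "sub a b = result (reg_val a - reg_val b)"

definition mul :: "reg \<Rightarrow> reg \<Rightarrow> reg ram" where
  "mul a b = result (reg_val a * reg_val b)"

definition quo :: "reg \<Rightarrow> reg \<Rightarrow> reg ram" where
  "quo a b = (if reg_val b = 0 then (\<lambda>w. None) else result (reg_val a div reg_val b))"

definition rest :: "reg \<Rightarrow> reg \<Rightarrow> reg ram" where
  "rest a b = (if reg_val b = 0 then (\<lambda>w. None) else result (reg_val a mod reg_val b))"

definition leq :: "reg \<Rightarrow> reg \<Rightarrow> bool ram" where
  "leq a b = (\<lambda>w. Some (reg_val a \<le> reg_val b, 1))"

definition equ :: "reg \<Rightarrow> reg \<Rightarrow> bool ram" where
  "equ a b = (\<lambda>w. Some (reg_val a = reg_val b, 1))"

definition tick :: "unit ram" where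
  "tick = (\<lambda>w. Some ((), 1))"

text \<open>Not an instruction: exposes the cost of a computation in its result.\<close>

definition timed :: "'a ram \<Rightarrow> ('a \<times> nat) ram" where
  "timed p = (\<lambda>w. case p w of None \<Rightarrow> None | Some (x, t) \<Rightarrow> Some ((x, t), t))"

section \<open>The algorithm as a word RAM program\<close>

definition both :: "bool ram \<Rightarrow> bool ram \<Rightarrow> bool ram" where
  "both p q = do { x \<leftarrow> p; if x then q else ret False }"

definition neg_reg :: "reg \<Rightarrow> reg ram" where
  "neg_reg x = do { zero \<leftarrow> load 0; sub zero x }"

definition abs_reg :: "reg \<Rightarrow> reg ram" where
  "abs_reg x = do { zero \<leftarrow> load 0; b \<leftarrow> leq zero x; if b then ret x else sub zero x }"

definition max_reg :: "reg \<Rightarrow> reg \<Rightarrow> reg ram" where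
  "max_reg x y = do { b \<leftarrow> leq x y; ret (if b then y else x) }"

definition min_reg :: "reg \<Rightarrow> reg \<Rightarrow> reg ram" where
  "min_reg x y = do { b \<leftarrow> leq x y; ret (if b then x else y) }"

fun add_point :: "rpoint \<Rightarrow> rpoint \<Rightarrow> rpoint ram" where
  "add_point (x, y) (x', y') = do { u \<leftarrow> add x x'; v \<leftarrow> add y y'; ret (u, v) }"

fun sub_point :: "rpoint \<Rightarrow> rpoint \<Rightarrow> rpoint ram" where
  "sub_point (x, y) (x', y') = do { u \<leftarrow> sub x x'; v \<leftarrow> sub y y'; ret (u, v) }"

fun manhattan_ram :: "rpoint \<Rightarrow> reg ram" where
  "manhattan_ram (x, y) = do { u \<leftarrow> abs_reg x; v \<leftarrow> abs_reg y; add u v }"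

fun lattice_ram :: "reg \<Rightarrow> reg \<Rightarrow> reg \<Rightarrow> rpoint ram" where
  "lattice_ram k m n = do {
     one \<leftarrow> load 1; k1 \<leftarrow> add k one;
     mk \<leftarrow> mul m k; nk1 \<leftarrow> mul n k1; x \<leftarrow> sub mk nk1;
     mk1 \<leftarrow> mul m k1; nk \<leftarrow> mul n k; y \<leftarrow> add mk1 nk;
     ret (x, y) }"

definition nearest_ram :: "reg \<Rightarrow> reg \<Rightarrow> reg ram" where
  "nearest_ram u N = do {
     two \<leftarrow> load 2; u2 \<leftarrow> mul two u; s \<leftarrow> add u2 N; N2 \<leftarrow> mul two N; quo s N2 }"

text \<open>Implements \<^const>\<open>gmod\<close>: the quotient \<open>z / (k + (k+1) i) = (u + v i) / N\<close> is rounded to a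
  nearest Gaussian integer, and that multiple of \<open>k + (k+1) i\<close> is subtracted. A point is in
  \<^term>\<open>disc k\<close> iff its \<open>u\<close> and \<open>v\<close> have absolute value at most \<open>k (k+1) = (N-1) / 2\<close>, so
  the remainder is the canonical representative.\<close>

fun gmod_ram :: "reg \<Rightarrow> rpoint \<Rightarrow> rpoint ram" where
  "gmod_ram k (x, y) = do {
     one \<leftarrow> load 1; k1 \<leftarrow> add k one;
     kk \<leftarrow> mul k k; kk1 \<leftarrow> mul k1 k1; N \<leftarrow> add kk kk1;
     xk \<leftarrow> mul x k; yk1 \<leftarrow> mul y k1; u \<leftarrow> add xk yk1;
     yk \<leftarrow> mul y k; xk1 \<leftarrow> mul x k1; v \<leftarrow> sub yk xk1;
     m \<leftarrow> nearest_ram u N; n \<leftarrow> nearest_ram v N;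
     l \<leftarrow> lattice_ram k m n;
     sub_point (x, y) l }"

definition gdist_ram :: "reg \<Rightarrow> rpoint \<Rightarrow> rpoint \<Rightarrow> reg ram" where
  "gdist_ram k U V = do { W \<leftarrow> sub_point U V; Z \<leftarrow> gmod_ram k W; manhattan_ram Z }"

definition has_dist :: "reg \<Rightarrow> rpoint \<Rightarrow> rpoint \<Rightarrow> bool ram" where
  "has_dist k U V = do { r \<leftarrow> gdist_ram k U V; equ r k }"

definition intersecting_ram ::
  "reg \<Rightarrow> rpoint \<Rightarrow> rpoint \<Rightarrow> rpoint \<Rightarrow> reg \<Rightarrow> reg \<Rightarrow> reg \<Rightarrow> reg \<Rightarrow> reg \<Rightarrow> reg \<Rightarrow> rpoint option ram" where
  "intersecting_ram k A B C' s1 s2 s3 s4 M D = do {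
     ks4 \<leftarrow> mul k s4; s2M \<leftarrow> mul s2 M; pn \<leftarrow> sub ks4 s2M;
     s1M \<leftarrow> mul s1 M; ks3 \<leftarrow> mul k s3; qn \<leftarrow> sub s1M ks3;
     zero \<leftarrow> load 0; rp \<leftarrow> rest pn D; rq \<leftarrow> rest qn D;
     integral \<leftarrow> both (equ rp zero) (equ rq zero);
     if integral then do {
       p \<leftarrow> quo pn D; q \<leftarrow> quo qn D;
       ok \<leftarrow> both (do { r \<leftarrow> manhattan_ram (p, q); equ r k })
                  (do { z \<leftarrow> sub_point (p, q) C'; r \<leftarrow> manhattan_ram z; equ r k });
       if ok then do {
         S \<leftarrow> add_point A (p, q);
         NS \<leftarrow> gmod_ram k S;
         valid \<leftarrow> both (has_dist k NS A) (has_dist k NS B);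
         ret (if valid then Some NS else None) }
       else ret None }
     else ret None }"

text \<open>\<open>C'\<close> is the shifted point \<open>(c', d')\<close>, \<open>C\<close> the unshifted one.\<close>

fun parallel_ram ::
  "reg \<Rightarrow> rpoint \<Rightarrow> rpoint \<Rightarrow> rpoint \<Rightarrow> bool \<Rightarrow> reg \<Rightarrow> reg \<Rightarrow> reg \<Rightarrow> reg \<Rightarrow> reg \<Rightarrow> rpoint option ram" where
  "parallel_ram k A C (c', d') low_end s1 s2 s3 s4 M = do {
     zero \<leftarrow> load 0;
     s1c \<leftarrow> mul s1 c'; s2d \<leftarrow> mul s2 d'; ks2d \<leftarrow> sub k s2d;
     n1 \<leftarrow> neg_reg s1; n2 \<leftarrow> neg_reg s2; nk \<leftarrow> neg_reg k;
     same \<leftarrow> both (equ s3 s1) (both (equ s4 s2) (equ M k));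
     opposite \<leftarrow> both (equ s3 n1) (both (equ s4 n2) (equ M nk));
     interval \<leftarrow>
       (if same then do { l \<leftarrow> max_reg zero s1c; h \<leftarrow> min_reg k ks2d; ret (Some (l, h)) }
        else if opposite then do { l \<leftarrow> max_reg zero ks2d; h \<leftarrow> min_reg k s1c; ret (Some (l, h)) }
        else ret None);
     case interval of
       None \<Rightarrow> ret None
     | Some (l, h) \<Rightarrow> do {
         nonempty \<leftarrow> leq l h;
         if nonempty then do {
           t \<leftarrow> ret (if low_end then l else h);
           p \<leftarrow> mul s1 t; kt \<leftarrow> sub k t; q \<leftarrow> mul s2 kt;
           valid \<leftarrow> both (has_dist k (p, q) (zero, zero)) (has_dist k (p, q) C);
           if valid then do { S \<leftarrow> add_point A (p, q); NS \<leftarrow> gmod_ram k S; ret (Some NS) }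
           else ret None }
         else ret None } }"

fun case_ram ::
  "reg \<Rightarrow> rpoint \<Rightarrow> rpoint \<Rightarrow> rpoint \<Rightarrow> (case_id \<Rightarrow> bool) \<Rightarrow> case_id \<Rightarrow> rpoint option ram" where
  "case_ram k A B C low ((i, j), (i1, i2, i3, i4)) = do {
     m \<leftarrow> load i; n \<leftarrow> load j;
     s1 \<leftarrow> load i1; s2 \<leftarrow> load i2; s3 \<leftarrow> load i3; s4 \<leftarrow> load i4;
     L \<leftarrow> lattice_ram k m n;
     (c', d') \<leftarrow> add_point C L;
     s3c \<leftarrow> mul s3 c'; s4d \<leftarrow> mul s4 d'; ks3c \<leftarrow> add k s3c; M \<leftarrow> add ks3c s4d;
     s14 \<leftarrow> mul s1 s4; s23 \<leftarrow> mul s2 s3; D \<leftarrow> sub s14 s23;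
     zero \<leftarrow> load 0; is_parallel \<leftarrow> equ D zero;
     if is_parallel
       then parallel_ram k A C (c', d') (low ((i, j), (i1, i2, i3, i4))) s1 s2 s3 s4 M
       else intersecting_ram k A B (c', d') s1 s2 s3 s4 M D }"

text \<open>The second component of the result has one entry per examined case, namely the number of
  instructions that were spent on it.\<close>

primrec search_ram :: "('c \<Rightarrow> 'b option ram) \<Rightarrow> 'c list \<Rightarrow> ('b option \<times> nat list) ram" where
  "search_ram f [] = ret (None, [])"
| "search_ram f (x # xs) = do {
     tick;
     (r, t) \<leftarrow> timed (f x);
     case r of
       None \<Rightarrow> do { (r', ts) \<leftarrow> search_ram f xs; ret (r', t # ts) }
     | Some y \<Rightarrow> ret (Some y, [t]) }"

definition select_source_ram ::
  "(case_id \<Rightarrow> bool) \<Rightarrow> case_id list \<Rightarrow> reg \<Rightarrow> rpoint \<Rightarrow> rpoint \<Rightarrow> (rpoint option \<times> nat list) ram" where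
  "select_source_ram low cs k A B = do {
     W \<leftarrow> sub_point B A;
     C \<leftarrow> gmod_ram k W;
     search_ram (case_ram k A B C low) cs }"

definition reg_point :: "point \<Rightarrow> rpoint" where
  "reg_point z = (Reg (fst z), Reg (snd z))"

end

(* The coordinates occurring in the algorithm are O(k), and the only quadratic intermediate values,
   those of the reduction gmod, are O(k^2) = O(num_nodes k). So a word with a constant number of bits
   beyond num_nodes k never overflows, and then the cost of a case, which is loop-free, is
   bounded by a constant, and there are 144 cases. The rounding in gmod_ram yields the canonical
   representative because the rotation z -> z * (k - (k+1) i) maps the disc onto the multiples of
   that number in the square |u|, |v| <= k(k+1) = (N-1)/2, while lattice vectors become multiples
   of N. *)

theory Submission
  imports Defs
begin

section \<open>Canonical representatives\<close>

text \<open>With \<open>u + v i = (x + y i) * (k - (k+1) i)\<close>, the bounds on \<open>u\<close>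
  and \<open>v\<close> come from the triangle inequality. Conversely, inverting this map writes
  \<open>N\<close> times each of \<open>x + y\<close>, \<open>x - y\<close>, \<open>y - x\<close>,
  \<open>- x - y\<close> as \<open>(2*k+1)*a + b\<close>, where \<open>a\<close> and
  \<open>b\<close> are \<open>u\<close> and \<open>v\<close> up to order and sign.\<close>

lemma disc_iff_rotated:
  assumes "0 < k"
  shows "(x, y) \<in> disc k \<longleftrightarrow>
    \<bar>x * k + y * (k + 1)\<bar> \<le> k * (k + 1) \<and> \<bar>y * k - x * (k + 1)\<bar> \<le> k * (k + 1)"
    (is "_ \<longleftrightarrow> \<bar>?u\<bar> \<le> _ \<and> \<bar>?v\<bar> \<le> _")
proof
  assume "(x, y) \<in> disc k"
  then have xy: "\<bar>x\<bar> + \<bar>y\<bar> \<le> k"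
    by (simp add: disc_def manhattan_def)
  have bound: "\<bar>a * k + b * (k + 1)\<bar> \<le> k * (k + 1)" if "\<bar>a\<bar> + \<bar>b\<bar> \<le> k" for a b
  proof -
    have "\<bar>a * k + b * (k + 1)\<bar> \<le> \<bar>a\<bar> * k + \<bar>b\<bar> * (k + 1)"
      using assms abs_triangle_ineq[of "a * k" "b * (k + 1)"] by (simp add: abs_mult)
    also have "\<dots> \<le> (\<bar>a\<bar> + \<bar>b\<bar>) * (k + 1)"
      by (simp add: algebra_simps)
    also have "\<dots> \<le> k * (k + 1)"
      using that assms by (intro mult_right_mono) auto
    finally show ?thesis .
  qed
  \<comment> \<open>The coordinate \<open>v\<close> is \<open>u\<close> taken at
    \<open>(y, - x)\<close>, a point of the same Manhattan length.\<close>
  from bound[of x y] bound[of y "- x"] xy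
  show "\<bar>?u\<bar> \<le> k * (k + 1) \<and> \<bar>?v\<bar> \<le> k * (k + 1)"
    by (simp add: algebra_simps)
next
  assume uv: "\<bar>?u\<bar> \<le> k * (k + 1) \<and> \<bar>?v\<bar> \<le> k * (k + 1)"
  define N where "N = k * k + (k + 1) * (k + 1)"
  have N: "0 < N"
    using assms by (simp add: N_def add_pos_pos)
  have small: "z \<le> k" if "N * z = (2 * k + 1) * a + b"
    "\<bar>a\<bar> \<le> k * (k + 1)" "\<bar>b\<bar> \<le> k * (k + 1)" for z a b
  proof -
    have "(2 * k + 1) * a \<le> (2 * k + 1) * (k * (k + 1))"
      using that assms by (intro mult_left_mono) auto
    with that have "N * z \<le> (2 * k + 1) * (k * (k + 1)) + k * (k + 1)"
      by linarith
    \<comment> \<open>The left side is \<open>2*k*(k+1)^2\<close> and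
      \<open>N = 2*k*(k+1) + 1\<close>, so the gap is exactly \<open>k + 1\<close>; integrality then
      turns \<open>z < k + 1\<close> into the claim.\<close>
    also have "\<dots> < N * (k + 1)"
      using assms by (simp add: N_def algebra_simps)
    finally show ?thesis
      using N by (simp add: mult_less_cancel_left_pos)
  qed
  have "x + y \<le> k"
    using uv by (intro small[of _ ?u "- ?v"]) (auto simp: N_def algebra_simps)
  moreover have "x - y \<le> k"
    using uv by (intro small[of _ "- ?v" "- ?u"]) (auto simp: N_def algebra_simps)
  moreover have "y - x \<le> k"
    using uv by (intro small[of _ ?v ?u]) (auto simp: N_def algebra_simps)
  moreover have "- x - y \<le> k"
    using uv by (intro small[of _ "- ?u" ?v]) (auto simp: N_def algebra_simps)
  ultimately show "(x, y) \<in> disc k"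
    by (auto simp: disc_def manhattan_def)
qed

text \<open>Rotated coordinates of equivalent points differ by multiples of \<open>N\<close>,
  whereas those of two points of the disc differ by at most \<open>2*k*(k+1) = N - 1\<close>. Hence
  only one candidate exists and the definite description is determined.\<close>

lemma gmod_eqI:
  assumes "0 < k" and z': "z' \<in> disc k" and same: "same_node k z z'"
  shows "gmod k z = z'"
  unfolding gmod_def
proof (rule the_equality)
  show "z' \<in> disc k \<and> same_node k z z'"
    using z' same by simp
  fix z'' assume z'': "z'' \<in> disc k \<and> same_node k z z''"
  obtain x y x' y' where eqs: "z' = (x, y)" "z'' = (x', y')"
    by fastforce
  from same z'' obtain m n m' n' where
    "z - z' = lattice_vec k m n" "z - z'' = lattice_vec k m' n'"
    by (auto simp: same_node_def)
  then have "z'' - z' = lattice_vec k m n - lattice_vec k m' n'"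
    by (simp add: algebra_simps)
  then have d: "x' - x = (m - m') * k - (n - n') * (k + 1)"
    "y' - y = (m - m') * (k + 1) + (n - n') * k"
    by (auto simp: eqs lattice_vec_def algebra_simps)
  \<comment> \<open>This is \<open>k^2 + (k+1)^2\<close>, written so as to compare directly with
    twice the half-width \<open>k*(k+1)\<close> of the square.\<close>
  define N where "N = 2 * (k * (k + 1)) + 1"
  have N: "0 < N"
    using assms by (simp add: N_def add_pos_pos)
  have zero: "i = 0" if "a - b = N * i" "\<bar>a\<bar> \<le> k * (k + 1)" "\<bar>b\<bar> \<le> k * (k + 1)" for a b i
  proof -
    have "N * \<bar>i\<bar> = \<bar>a - b\<bar>"
      using that(1) N by (simp add: abs_mult)
    also have "\<dots> \<le> 2 * (k * (k + 1))"
      using that(2,3) by linarith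
    also have "\<dots> < N * 1"
      by (simp add: N_def)
    finally have "N * \<bar>i\<bar> < N * 1" .
    then have "\<bar>i\<bar> < 1"
      using N by (simp only: mult_less_cancel_left_pos)
    then show ?thesis by simp
  qed
  from disc_iff_rotated[OF \<open>0 < k\<close>, of x y] disc_iff_rotated[OF \<open>0 < k\<close>, of x' y'] z' z''
  have b: "\<bar>x * k + y * (k + 1)\<bar> \<le> k * (k + 1)" "\<bar>y * k - x * (k + 1)\<bar> \<le> k * (k + 1)"
    "\<bar>x' * k + y' * (k + 1)\<bar> \<le> k * (k + 1)" "\<bar>y' * k - x' * (k + 1)\<bar> \<le> k * (k + 1)"
    by (auto simp: eqs)
  have "x' * k + y' * (k + 1) - (x * k + y * (k + 1)) = (x' - x) * k + (y' - y) * (k + 1)"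
    by (simp add: algebra_simps)
  also have "\<dots> = N * (m - m')"
    unfolding d by (simp add: N_def algebra_simps)
  finally have "m - m' = 0"
    using b zero by blast
  moreover have "y' * k - x' * (k + 1) - (y * k - x * (k + 1)) = (y' - y) * k - (x' - x) * (k + 1)"
    by (simp add: algebra_simps)
  then have "y' * k - x' * (k + 1) - (y * k - x * (k + 1)) = N * (n - n')"
    unfolding d by (simp add: N_def algebra_simps)
  then have "n - n' = 0"
    using b zero by blast
  ultimately show "z'' = z'"
    using d by (simp add: eqs)
qed

section \<open>Reduction by rounding to a nearest lattice point\<close>

text \<open>The quotient \<open>q\<close> is \<open>u/N + 1/2\<close> rounded down, so its remainder
  gives \<open>- N <= 2*(u - N*q) < N\<close>. As \<open>N\<close> is odd, this leaves a distance of
  at most \<open>h\<close>.\<close>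

lemma nearest_multiple:
  fixes u N h :: int
  assumes "N = 2 * h + 1" "0 \<le> h"
  shows "\<bar>u - N * ((2 * u + N) div (2 * N))\<bar> \<le> h"
proof -
  define q where "q = (2 * u + N) div (2 * N)"
  have "0 \<le> (2 * u + N) mod (2 * N)" "(2 * u + N) mod (2 * N) < 2 * N"
    using assms by auto
  moreover have "(2 * u + N) mod (2 * N) = 2 * u + N - 2 * (N * q)"
    by (simp add: q_def minus_div_mult_eq_mod [symmetric] algebra_simps)
  ultimately show ?thesis
    using assms unfolding q_def[symmetric] by linarith
qed

text \<open>Subtracting \<open>lattice_vec k m n\<close> lowers the two rotated coordinates by
  \<open>N*m\<close> and \<open>N*n\<close>, so they can be rounded independently. This also
  supplies the existence of a representative; uniqueness is \<open>gmod_eqI\<close>.\<close>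

lemma gmod_rounded:
  assumes "0 < k"
  defines "N \<equiv> k * k + (k + 1) * (k + 1)"
  defines "m \<equiv> \<lambda>x y. (2 * (x * k + y * (k + 1)) + N) div (2 * N)"
  defines "n \<equiv> \<lambda>x y. (2 * (y * k - x * (k + 1)) + N) div (2 * N)"
  shows "(x, y) - lattice_vec k (m x y) (n x y) \<in> disc k"
    and "gmod k (x, y) = (x, y) - lattice_vec k (m x y) (n x y)"
proof -
  have N: "N = 2 * (k * (k + 1)) + 1" "0 \<le> k * (k + 1)"
    using assms(1) by (auto simp: N_def algebra_simps)
  have "\<bar>x * k + y * (k + 1) - N * m x y\<bar> \<le> k * (k + 1)"
    "\<bar>y * k - x * (k + 1) - N * n x y\<bar> \<le> k * (k + 1)"
    unfolding m_def n_def by (rule nearest_multiple[OF N])+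
  then show disc: "(x, y) - lattice_vec k (m x y) (n x y) \<in> disc k"
    by (simp add: lattice_vec_def disc_iff_rotated[OF assms(1)] N_def) (simp add: algebra_simps)
  show "gmod k (x, y) = (x, y) - lattice_vec k (m x y) (n x y)"
    by (rule gmod_eqI[OF assms(1) disc]) (auto simp: same_node_def)
qed

lemma gmod_in_disc: "0 < k \<Longrightarrow> gmod k z \<in> disc k"
  by (cases z) (simp only: gmod_rounded)

lemma disc_bounds:
  assumes "z \<in> disc k"
  shows "\<bar>fst z\<bar> \<le> k" "\<bar>snd z\<bar> \<le> k"
  using assms by (auto simp: disc_def manhattan_def)

section \<open>Cost-bounded execution\<close>

text \<open>Absence of failure, the value and an upper bound on the cost are kept together. Using a
  bound instead of the exact cost lets branches of different lengths share one statement.\<close>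

definition computes :: "nat \<Rightarrow> 'a ram \<Rightarrow> 'a \<Rightarrow> nat \<Rightarrow> bool" where
  "computes w p x c \<longleftrightarrow> (\<exists>t\<le>c. p w = Some (x, t))"

lemma computes_mono: "computes w p x c \<Longrightarrow> c \<le> d \<Longrightarrow> computes w p x d"
  by (auto simp: computes_def)

lemma computes_ret: "x = y \<Longrightarrow> computes w (ret x) y 0"
  by (simp add: computes_def ret_def)

lemma computes_bind:
  assumes "computes w p x c" "computes w (f x) y d"
  shows "computes w (ram_bind p f) y (c + d)"
  using assms by (force simp: computes_def ram_bind_def)

text \<open>The second test runs only after the first has succeeded, so its own range conditions may
  be proved under \<open>x\<close>.\<close>

lemma computes_both:
  assumes "computes w p x c" "x \<Longrightarrow> computes w q y d"
  shows "computes w (both p q) (x \<and> y) (c + d)"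
  unfolding both_def
  by (rule computes_bind[OF assms(1)]) (use assms(2) in \<open>auto simp: computes_def ret_def\<close>)

lemma computes_if_same:
  assumes "b \<Longrightarrow> computes w p x c" "\<not> b \<Longrightarrow> computes w q x d"
  shows "computes w (if b then p else q) x (max c d)"
  using assms by (auto intro: computes_mono)

lemma computes_if:
  assumes "b \<Longrightarrow> computes w p x c" "\<not> b \<Longrightarrow> computes w q y d"
  shows "computes w (if b then p else q) (if b then x else y) (max c d)"
  using assms by (auto intro: computes_mono)

lemma computes_instr:
  "\<bar>v\<bar> < 2 ^ w \<Longrightarrow> computes w (load v) (Reg v) 1"
  "\<bar>a + b\<bar> < 2 ^ w \<Longrightarrow> computes w (add (Reg a) (Reg b)) (Reg (a + b)) 1"
  "\<bar>a - b\<bar> < 2 ^ w \<Longrightarrow> computes w (sub (Reg a) (Reg b)) (Reg (a - b)) 1"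
  "\<bar>a * b\<bar> < 2 ^ w \<Longrightarrow> computes w (mul (Reg a) (Reg b)) (Reg (a * b)) 1"
  "\<bar>a div b\<bar> < 2 ^ w \<Longrightarrow> b \<noteq> 0 \<Longrightarrow> computes w (quo (Reg a) (Reg b)) (Reg (a div b)) 1"
  "\<bar>a mod b\<bar> < 2 ^ w \<Longrightarrow> b \<noteq> 0 \<Longrightarrow> computes w (rest (Reg a) (Reg b)) (Reg (a mod b)) 1"
  "computes w (leq (Reg a) (Reg b)) (a \<le> b) 1"
  "computes w (equ (Reg a) (Reg b)) (a = b) 1"
  by (auto simp: computes_def load_def add_def sub_def mul_def quo_def rest_def leq_def equ_def
      result_def)

text \<open>The continuation is the first premise: resolving it first runs through the whole program and
  leaves the overflow conditions, free of unknowns, for the end.\<close>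

lemma computes_instr_bind:
  "computes w (f (Reg v)) y c \<Longrightarrow> \<bar>v\<bar> < 2 ^ w \<Longrightarrow> computes w (ram_bind (load v) f) y (1 + c)"
  "computes w (f (Reg (a + b))) y c \<Longrightarrow> \<bar>a + b\<bar> < 2 ^ w \<Longrightarrow>
    computes w (ram_bind (add (Reg a) (Reg b)) f) y (1 + c)"
  "computes w (f (Reg (a - b))) y c \<Longrightarrow> \<bar>a - b\<bar> < 2 ^ w \<Longrightarrow>
    computes w (ram_bind (sub (Reg a) (Reg b)) f) y (1 + c)"
  "computes w (f (Reg (a * b))) y c \<Longrightarrow> \<bar>a * b\<bar> < 2 ^ w \<Longrightarrow>
    computes w (ram_bind (mul (Reg a) (Reg b)) f) y (1 + c)"
  "computes w (f (Reg (a div b))) y c \<Longrightarrow> \<bar>a div b\<bar> < 2 ^ w \<Longrightarrow> b \<noteq> 0 \<Longrightarrow>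
    computes w (ram_bind (quo (Reg a) (Reg b)) f) y (1 + c)"
  "computes w (f (Reg (a mod b))) y c \<Longrightarrow> \<bar>a mod b\<bar> < 2 ^ w \<Longrightarrow> b \<noteq> 0 \<Longrightarrow>
    computes w (ram_bind (rest (Reg a) (Reg b)) f) y (1 + c)"
  "computes w (g (a \<le> b)) y c \<Longrightarrow> computes w (ram_bind (leq (Reg a) (Reg b)) g) y (1 + c)"
  "computes w (g (a = b)) y c \<Longrightarrow> computes w (ram_bind (equ (Reg a) (Reg b)) g) y (1 + c)"
  by (rule computes_bind, (rule computes_instr; assumption), assumption)+

lemma computes_ret_bind: "computes w (f x) y c \<Longrightarrow> computes w (ram_bind (ret x) f) y c"
  using computes_bind[OF computes_ret[OF refl], of w f x y c] by simp

lemma computes_case_prod: "computes w (f a b) y c \<Longrightarrow> computes w (case_prod f (a, b)) y c"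
  by simp

lemmas computes_step = computes_instr_bind computes_ret_bind computes_case_prod

lemma computes_abs:
  "\<bar>a\<bar> < 2 ^ w \<Longrightarrow> computes w (abs_reg (Reg a)) (Reg \<bar>a\<bar>) 3"
  unfolding abs_reg_def
  apply (rule computes_mono)
   apply (rule computes_step)+
    apply (rule computes_if_same)
     apply (rule computes_ret)
     apply simp
    \<comment> \<open>In the remaining branch \<open>a\<close> is negative, and the program forms
      \<open>0 - a\<close>.\<close>
    apply (subgoal_tac "\<bar>a\<bar> = 0 - a")
     apply (simp only:, rule computes_instr)
     apply simp_all
  done

lemma computes_neg: "\<bar>a\<bar> < 2 ^ w \<Longrightarrow> computes w (neg_reg (Reg a)) (Reg (- a)) 2"
  unfolding neg_reg_def diff_0 [of a, symmetric]
  by (rule computes_mono, rule computes_step, rule computes_instr) auto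

lemma computes_max: "computes w (max_reg (Reg a) (Reg b)) (Reg (max a b)) 1"
  and computes_min: "computes w (min_reg (Reg a) (Reg b)) (Reg (min a b)) 1"
  by (auto simp: max_reg_def min_reg_def computes_def ram_bind_def leq_def ret_def)

lemma computes_add_point:
  assumes "\<bar>a + c\<bar> < 2 ^ w" "\<bar>b + d\<bar> < 2 ^ w"
  shows "computes w (add_point (Reg a, Reg b) (Reg c, Reg d)) (Reg (a + c), Reg (b + d)) 2"
  unfolding add_point.simps
  by (rule computes_mono, (rule computes_step)+, rule computes_ret) (use assms in auto)

lemma computes_sub_point:
  assumes "\<bar>a - c\<bar> < 2 ^ w" "\<bar>b - d\<bar> < 2 ^ w"
  shows "computes w (sub_point (Reg a, Reg b) (Reg c, Reg d)) (Reg (a - c), Reg (b - d)) 2"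
  unfolding sub_point.simps
  by (rule computes_mono, (rule computes_step)+, rule computes_ret) (use assms in auto)

lemma computes_manhattan:
  assumes "\<bar>a\<bar> + \<bar>b\<bar> < 2 ^ w"
  shows "computes w (manhattan_ram (Reg a, Reg b)) (Reg (manhattan (a, b))) 7"
proof -
  have "computes w (manhattan_ram (Reg a, Reg b)) (Reg (\<bar>a\<bar> + \<bar>b\<bar>)) (3 + (3 + 1))"
    unfolding manhattan_ram.simps
    by (rule computes_bind[OF computes_abs, rotated] computes_instr)+ (use assms in auto)
  then show ?thesis by (simp add: manhattan_def)
qed

text \<open>The rotation makes the continuation the first premise, as for single instructions, and
  postpones the range conditions of the subroutine.\<close>

lemmas computes_call =
  computes_bind[OF computes_add_point, rotated 2]
  computes_bind[OF computes_sub_point, rotated 2]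
  computes_bind[OF computes_manhattan, rotated 1]
  computes_bind[OF computes_neg, rotated 1]

text \<open>Induction on the list: each examined case adds one entry to \<open>steps\<close> and at
  most \<open>1 + c\<close> to the cost, the extra unit being \<open>tick\<close>. A success ends
  the search, so \<open>steps\<close> can be shorter than the list.\<close>

lemma computes_search:
  assumes "\<And>x. x \<in> set xs \<Longrightarrow> computes w (f x) (g x) c"
  shows "\<exists>steps t. search_ram f xs w = Some ((first_result g xs, steps), t) \<and>
    length steps \<le> length xs \<and> (\<forall>s \<in> set steps. s \<le> c) \<and> t \<le> length xs * (1 + c)"
  using assms
proof (induction xs)
  case Nil
  then show ?case by (simp add: ret_def)
next
  case (Cons x xs)
  from Cons.prems obtain t where t: "f x w = Some (g x, t)" "t \<le> c"
    by (force simp: computes_def)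
  from Cons obtain steps t' where IH: "search_ram f xs w = Some ((first_result g xs, steps), t')"
    "length steps \<le> length xs" "\<forall>s \<in> set steps. s \<le> c" "t' \<le> length xs * (1 + c)"
    by auto
  show ?case
    using t IH
    by (cases "g x") (auto simp: ram_bind_def tick_def timed_def ret_def)
qed

text \<open>Moves the encoding of points as registers out of the search, which links the program to
  \<open>select_source\<close>.\<close>

lemma first_result_map_option:
  "first_result (\<lambda>x. map_option h (g x)) xs = map_option h (first_result g xs)"
  by (induction xs) (auto split: option.split)

section \<open>Correctness within the word size\<close>

text \<open>The factor \<open>2 ^ 12\<close> absorbs the constants in the intermediate values. The
  largest quadratic one, \<open>2*u + N\<close> in the rounding, has leading coefficient at most 82,
  against 8192 available.\<close>

locale network_ram =
  fixes k :: int and w :: nat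
  assumes k_pos: "0 < k"
    and word: "2 ^ 12 * num_nodes k \<le> 2 ^ w"
begin

lemma word_quadratic: "8192 * (k * k) + 8192 * k + 4096 \<le> 2 ^ w"
  using word by (simp add: num_nodes_def power2_eq_square algebra_simps)

lemma word_linear: "16384 * k + 4096 \<le> 2 ^ w"
proof -
  have "k \<le> k * k"
    using k_pos by (simp add: mult_le_cancel_left1)
  with word_quadratic show ?thesis by linarith
qed

text \<open>Resolving with these rules along an arithmetic expression builds a bound of the same
  shape, to be compared with the word size afterwards.\<close>

lemma abs_bounds:
  "\<bar>a :: int\<bar> \<le> \<alpha> \<Longrightarrow> \<bar>b\<bar> \<le> \<beta> \<Longrightarrow> \<bar>a + b\<bar> \<le> \<alpha> + \<beta>"
  "\<bar>a :: int\<bar> \<le> \<alpha> \<Longrightarrow> \<bar>b\<bar> \<le> \<beta> \<Longrightarrow> \<bar>a - b\<bar> \<le> \<alpha> + \<beta>"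
  "\<bar>a :: int\<bar> \<le> \<alpha> \<Longrightarrow> \<bar>b\<bar> \<le> \<beta> \<Longrightarrow> \<bar>a * b\<bar> \<le> \<alpha> * \<beta>"
  "\<bar>0 :: int\<bar> \<le> 0" "\<bar>1 :: int\<bar> \<le> 1" "\<bar>2 :: int\<bar> \<le> 2" "\<bar>k\<bar> \<le> k"
  using k_pos by (auto simp: abs_mult intro: mult_mono)

section \<open>Cost of reduction and of distance tests\<close>

text \<open>The bound 30 serves both callers: the loop shifts, of size at most 1, and the rounded
  quotients in \<open>gmod_ram\<close>.\<close>

lemma computes_lattice:
  assumes "\<bar>m\<bar> \<le> 30" "\<bar>n\<bar> \<le> 30"
  shows "computes w (lattice_ram (Reg k) (Reg m) (Reg n))
    (Reg (fst (lattice_vec k m n)), Reg (snd (lattice_vec k m n))) 8"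
  unfolding lattice_ram.simps
  apply (rule computes_mono, (rule computes_step)+, rule computes_ret)
           apply (simp add: lattice_vec_def)
          apply (rule order_le_less_trans, (rule assms abs_bounds)+,
      use word_quadratic word_linear k_pos in \<open>simp add: algebra_simps\<close>)+
  apply simp
  done

text \<open>The hypothesis has the shape that \<open>abs_bounds\<close> yields for
  \<open>x*k + y*(k+1)\<close> and \<open>y*k - x*(k+1)\<close> when both coordinates are at most
  \<open>20*k\<close> in absolute value.\<close>

lemma computes_nearest:
  assumes "\<bar>u\<bar> \<le> 20 * k * k + 20 * k * (k + 1)"
  defines "N \<equiv> k * k + (k + 1) * (k + 1)"
  shows "computes w (nearest_ram (Reg u) (Reg N)) (Reg ((2 * u + N) div (2 * N))) 5"
    and "\<bar>(2 * u + N) div (2 * N)\<bar> \<le> 30"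
proof -
  have N: "N = 2 * (k * k) + 2 * k + 1"
    by (simp add: N_def algebra_simps)
  have u: "\<bar>u\<bar> \<le> 40 * (k * k) + 20 * k"
    using assms(1) by (simp add: algebra_simps)
  show q: "\<bar>(2 * u + N) div (2 * N)\<bar> \<le> 30"
  proof -
    \<comment> \<open>Here \<bar>\<open>u\<close>\<bar> is below \<open>20*N\<close>, so
      \<open>2*u + N\<close> stays within \<open>41*N\<close> in absolute value, well inside
      \<open>60*N\<close>.\<close>
    have "N > 0" "2 * u + N \<le> 30 * (2 * N)" "- 30 * (2 * N) \<le> 2 * u + N"
      using u N k_pos by auto
    then have "(2 * u + N) div (2 * N) \<le> 30 * (2 * N) div (2 * N)"
      "- 30 * (2 * N) div (2 * N) \<le> (2 * u + N) div (2 * N)"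
      using zdiv_mono1[of "2 * u + N" "30 * (2 * N)" "2 * N"]
        zdiv_mono1[of "- 30 * (2 * N)" "2 * u + N" "2 * N"] by linarith+
    with \<open>N > 0\<close> show ?thesis
      by (simp only: nonzero_mult_div_cancel_right)
  qed
  show "computes w (nearest_ram (Reg u) (Reg N)) (Reg ((2 * u + N) div (2 * N))) 5"
    unfolding nearest_ram_def
    apply (rule computes_mono, (rule computes_step)+)
         apply (rule computes_instr)
    using u q word_quadratic word_linear k_pos N by (auto simp: algebra_simps)
qed

text \<open>The range \<open>20*k\<close> covers all arguments that occur: differences of points are
  at most \<open>2*k\<close> and sums \<open>A + (p, q)\<close> at most \<open>11*k\<close> per
  coordinate. The cost is 11 for \<open>N\<close>, \<open>u\<close>, \<open>v\<close>, twice 5 for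
  rounding, 8 for the lattice vector and 2 for the subtraction.\<close>

lemma computes_gmod:
  assumes "\<bar>x\<bar> \<le> 20 * k" "\<bar>y\<bar> \<le> 20 * k"
  shows "computes w (gmod_ram (Reg k) (Reg x, Reg y)) (reg_point (gmod k (x, y))) 31"
proof -
  define u where "u = x * k + y * (k + 1)"
  define v where "v = y * k - x * (k + 1)"
  define N where "N = k * k + (k + 1) * (k + 1)"
  define m where "m = (2 * u + N) div (2 * N)"
  define n where "n = (2 * v + N) div (2 * N)"
  have u: "\<bar>u\<bar> \<le> 20 * k * k + 20 * k * (k + 1)"
    unfolding u_def by (rule abs_bounds assms)+
  have v: "\<bar>v\<bar> \<le> 20 * k * k + 20 * k * (k + 1)"
    unfolding v_def by (rule abs_bounds assms)+
  note m = computes_nearest[OF u, folded N_def, folded m_def]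
  note n = computes_nearest[OF v, folded N_def, folded n_def]
  have eq: "gmod k (x, y) = (x, y) - lattice_vec k m n"
    using gmod_rounded(2)[OF k_pos, of x y]
    by (simp add: u_def v_def N_def m_def n_def)
  have disc: "\<bar>x - fst (lattice_vec k m n)\<bar> \<le> k" "\<bar>y - snd (lattice_vec k m n)\<bar> \<le> k"
    using disc_bounds[OF gmod_in_disc[OF k_pos, of "(x, y)"]] by (simp_all add: eq)
  have N: "\<bar>N\<bar> \<le> 2 * (k * k) + 2 * k + 1"
    using k_pos by (simp add: N_def algebra_simps)
  \<comment> \<open>The final subtraction cannot overflow because its result is the canonical
    representative, whose coordinates are at most \<open>k\<close>.\<close>
  have last: "computes w (sub_point (Reg x, Reg y)
      (Reg (fst (lattice_vec k m n)), Reg (snd (lattice_vec k m n)))) (reg_point (gmod k (x, y))) 2"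
    using computes_sub_point[of x "fst (lattice_vec k m n)" w y "snd (lattice_vec k m n)"]
      disc word_linear k_pos by (simp add: eq reg_point_def)
  show ?thesis
    unfolding gmod_ram.simps
    apply (rule computes_mono)
     apply (rule computes_step)+
                 \<comment> \<open>Folding the computed expressions makes the rounding facts
                   \<open>m\<close> and \<open>n\<close> applicable.\<close>
                 apply (unfold u_def[symmetric] v_def[symmetric] N_def[symmetric])
                 apply (rule computes_bind[OF m(1)] computes_bind[OF n(1)]
        computes_bind[OF computes_lattice[OF m(2) n(2)]] last)+
              apply (rule order_le_less_trans, (rule u v N assms abs_bounds)+,
        use word_quadratic word_linear k_pos in \<open>simp add: algebra_simps\<close>)+
    apply simp
    done
qed

lemma computes_has_dist:
  assumes "\<bar>x - x'\<bar> \<le> 20 * k" "\<bar>y - y'\<bar> \<le> 20 * k"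
  shows "computes w (has_dist (Reg k) (Reg x, Reg y) (Reg x', Reg y'))
    (gdist k (x, y) (x', y') = k) 41"
proof -
  have dist: "computes w (gdist_ram (Reg k) (Reg x, Reg y) (Reg x', Reg y'))
    (Reg (gdist k (x, y) (x', y'))) (2 + (31 + 7))"
    unfolding gdist_ram_def
  proof (rule computes_call computes_bind[OF computes_gmod, rotated 2])+
    define z where "z = gmod k (x - x', y - y')"
    have "computes w (manhattan_ram (Reg (fst z), Reg (snd z))) (Reg (manhattan (fst z, snd z))) 7"
      using disc_bounds[OF gmod_in_disc[OF k_pos, of "(x - x', y - y')"]] word_linear k_pos
      by (intro computes_manhattan) (simp add: z_def)
    then show "computes w (manhattan_ram (reg_point (gmod k (x - x', y - y'))))
      (Reg (gdist k (x, y) (x', y'))) 7"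
      by (simp add: gdist_def z_def reg_point_def)
  qed (use assms word_linear k_pos in auto)
  show ?thesis
    unfolding has_dist_def
    by (rule computes_mono, rule computes_bind, rule dist, rule computes_instr) simp
qed

section \<open>The case of intersecting edge lines\<close>

text \<open>Integer form of Cramer's rule for \<open>s1*p + s2*q = k\<close>,
  \<open>s3*p + s4*q = M\<close>: vanishing remainders replace the integrality test on real
  quotients.\<close>

definition intersecting_result :: "point \<Rightarrow> point \<Rightarrow> point \<Rightarrow> int \<Rightarrow> int \<Rightarrow> int \<Rightarrow> point option" where
  "intersecting_result A B C' pn qn D =
    (let p = pn div D; q = qn div D; NS = gmod k (A + (p, q))
     in if (pn mod D = 0 \<and> qn mod D = 0) \<and> (manhattan (p, q) = k \<and> manhattan ((p, q) - C') = k) \<and>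
       (gdist k NS A = k \<and> gdist k NS B = k) then Some NS else None)"

text \<open>The individual costs add up to at most 146; 200 is a round bound that the parallel case
  shares.\<close>

lemma computes_intersecting:
  assumes disc: "\<bar>a1\<bar> \<le> k" "\<bar>a2\<bar> \<le> k" "\<bar>b1\<bar> \<le> k" "\<bar>b2\<bar> \<le> k"
    and shifted: "\<bar>c'\<bar> \<le> 4 * k" "\<bar>d'\<bar> \<le> 4 * k" and M: "\<bar>M\<bar> \<le> 9 * k"
    and signs: "\<bar>s1\<bar> \<le> 1" "\<bar>s2\<bar> \<le> 1" "\<bar>s3\<bar> \<le> 1" "\<bar>s4\<bar> \<le> 1"
    and D: "\<bar>D\<bar> \<le> 2" "D \<noteq> 0"
  shows "computes w (intersecting_ram (Reg k) (Reg a1, Reg a2) (Reg b1, Reg b2) (Reg c', Reg d')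
      (Reg s1) (Reg s2) (Reg s3) (Reg s4) (Reg M) (Reg D))
    (map_option reg_point
      (intersecting_result (a1, a2) (b1, b2) (c', d') (k * s4 - s2 * M) (s1 * M - k * s3) D)) 200"
proof -
  define pn where "pn = k * s4 - s2 * M"
  define qn where "qn = s1 * M - k * s3"
  define p where "p = pn div D"
  define q where "q = qn div D"
  have prods: "\<bar>k * s4\<bar> \<le> k * 1" "\<bar>s2 * M\<bar> \<le> 1 * (9 * k)"
    "\<bar>s1 * M\<bar> \<le> 1 * (9 * k)" "\<bar>k * s3\<bar> \<le> k * 1"
    by (rule M signs abs_bounds)+
  have "\<bar>pn\<bar> \<le> k * 1 + 1 * (9 * k)" "\<bar>qn\<bar> \<le> 1 * (9 * k) + k * 1"
    unfolding pn_def qn_def by (rule M signs abs_bounds)+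
  then have pqn: "\<bar>pn\<bar> \<le> 10 * k" "\<bar>qn\<bar> \<le> 10 * k"
    by simp_all
  \<comment> \<open>Floor division may round away from zero, as in \<open>-1 div 2 = -1\<close>, yet
    it does not increase the absolute value.\<close>
  have div_le: "\<bar>n div D\<bar> \<le> \<bar>n\<bar>" for n
  proof -
    have "D = 1 \<or> D = - 1 \<or> D = 2 \<or> D = - 2"
      using D by linarith
    then show ?thesis
      by (elim disjE) simp_all
  qed
  have pq: "\<bar>p\<bar> \<le> 10 * k" "\<bar>q\<bar> \<le> 10 * k"
    unfolding p_def q_def by (rule order_trans[OF div_le pqn(1)] order_trans[OF div_le pqn(2)])+
  have mods: "\<bar>pn mod D\<bar> \<le> 2" "\<bar>qn mod D\<bar> \<le> 2"
    using D abs_mod_less[of D pn] abs_mod_less[of D qn] by auto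
  define NS where "NS = gmod k (a1 + p, a2 + q)"
  have NS: "\<bar>fst NS\<bar> \<le> k" "\<bar>snd NS\<bar> \<le> k"
    using disc_bounds[OF gmod_in_disc[OF k_pos]] by (simp_all add: NS_def)
  note word_simps = word_linear k_pos
  have on_sphere: "computes w (do { r \<leftarrow> manhattan_ram (Reg p, Reg q); equ r (Reg k) })
      (manhattan (p, q) = k) (7 + 1)"
    by (rule computes_call computes_instr)+ (use pq word_simps in auto)
  have on_shifted: "computes w (do { z \<leftarrow> sub_point (Reg p, Reg q) (Reg c', Reg d');
      r \<leftarrow> manhattan_ram z; equ r (Reg k) }) (manhattan (p - c', q - d') = k) (2 + (7 + 1))"
    by (rule computes_call computes_instr)+ (use pq shifted word_simps in auto)
  note dists = computes_both[OF on_sphere on_shifted]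
  let ?verify = "do { S \<leftarrow> add_point (Reg a1, Reg a2) (Reg p, Reg q);
    NS \<leftarrow> gmod_ram (Reg k) S;
    valid \<leftarrow> both (has_dist (Reg k) NS (Reg a1, Reg a2)) (has_dist (Reg k) NS (Reg b1, Reg b2));
    ret (if valid then Some NS else None) }"
  have verify: "computes w ?verify (if gdist k NS (a1, a2) = k \<and> gdist k NS (b1, b2) = k
      then Some (reg_point NS) else None) (2 + (31 + (41 + 41 + 0)))"
  proof (rule computes_call computes_bind[OF computes_gmod, rotated 2] computes_bind[rotated])+
    \<comment> \<open>\<open>computes_has_dist\<close> speaks of explicit pairs, so
      \<open>NS\<close> is split into coordinates, which the disc bounds by
      \<open>k\<close>.\<close>
    have "computes w (both (has_dist (Reg k) (Reg (fst NS), Reg (snd NS)) (Reg a1, Reg a2))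
        (has_dist (Reg k) (Reg (fst NS), Reg (snd NS)) (Reg b1, Reg b2)))
      (gdist k (fst NS, snd NS) (a1, a2) = k \<and> gdist k (fst NS, snd NS) (b1, b2) = k) (41 + 41)"
      by (rule computes_both; rule computes_has_dist) (use NS disc in auto)
    then show "computes w (both (has_dist (Reg k) (reg_point (gmod k (a1 + p, a2 + q))) (Reg a1, Reg a2))
        (has_dist (Reg k) (reg_point (gmod k (a1 + p, a2 + q))) (Reg b1, Reg b2)))
      (gdist k NS (a1, a2) = k \<and> gdist k NS (b1, b2) = k) (41 + 41)"
      by (simp add: reg_point_def NS_def)
  qed (use disc pq word_simps in \<open>auto intro: computes_ret simp: NS_def\<close>)
  \<comment> \<open>Nested conditionals follow the order in which the program tests.\<close>
  have result: "map_option reg_point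
      (intersecting_result (a1, a2) (b1, b2) (c', d') (k * s4 - s2 * M) (s1 * M - k * s3) D) =
    (if pn mod D = 0 \<and> qn mod D = 0 then
       if manhattan (p, q) = k \<and> manhattan (p - c', q - d') = k then
         if gdist k NS (a1, a2) = k \<and> gdist k NS (b1, b2) = k then Some (reg_point NS) else None
       else None
     else None)"
    unfolding intersecting_result_def Let_def
    by (fold pn_def qn_def, fold p_def q_def) (simp add: NS_def)
  show ?thesis
    unfolding intersecting_ram_def result
    apply (rule computes_mono)
     apply (rule computes_step)+
               apply (unfold pn_def[symmetric] qn_def[symmetric])
               apply (rule computes_bind)
                apply (rule computes_both computes_instr)+
               apply (rule computes_if)
                apply (rule computes_step)+
                  apply (unfold p_def[symmetric] q_def[symmetric])
                  apply (rule computes_bind[OF dists] computes_if verify computes_ret refl)+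
    apply (rule D computes_ret refl | rule order_le_less_trans, rule prods pq pqn mods abs_bounds,
        use word_linear k_pos in linarith)+
    apply simp
    done
qed

section \<open>The case of parallel edge lines\<close>

text \<open>For signs with \<open>D = 0\<close>, the lines \<open>s1*p + s2*q = k\<close> and
  \<open>s3*p + s4*q = M\<close> coincide exactly in the two listed cases. The endpoints then say
  that \<open>t\<close> lies between 0 and \<open>k\<close> and that \<open>p - c'\<close> and
  \<open>q - d'\<close> have the signs \<open>s3\<close> and \<open>s4\<close> or vanish.\<close>

definition parallel_interval ::
  "int \<Rightarrow> int \<Rightarrow> int \<Rightarrow> int \<Rightarrow> int \<Rightarrow> int \<Rightarrow> int \<Rightarrow> (int \<times> int) option" where
  "parallel_interval c' d' s1 s2 s3 s4 M =
    (if s3 = s1 \<and> (s4 = s2 \<and> M = k) then Some (max 0 (s1 * c'), min k (k - s2 * d'))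
     else if s3 = - s1 \<and> (s4 = - s2 \<and> M = - k) then Some (max 0 (k - s2 * d'), min k (s1 * c'))
     else None)"

definition parallel_result ::
  "point \<Rightarrow> point \<Rightarrow> (int \<times> int) option \<Rightarrow> bool \<Rightarrow> int \<Rightarrow> int \<Rightarrow> point option" where
  "parallel_result A C interval low_end s1 s2 =
    (case interval of
       None \<Rightarrow> None
     | Some (l, h) \<Rightarrow>
         (let t = if low_end then l else h; z = (s1 * t, s2 * (k - t))
          in if l \<le> h then
               if gdist k z 0 = k \<and> gdist k z C = k then Some (gmod k (A + z)) else None
             else None))"

lemma computes_parallel_tail:
  assumes disc: "\<bar>a1\<bar> \<le> k" "\<bar>a2\<bar> \<le> k" "\<bar>c1\<bar> \<le> k" "\<bar>c2\<bar> \<le> k"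
    and signs: "\<bar>s1\<bar> \<le> 1" "\<bar>s2\<bar> \<le> 1"
    and interval: "l \<le> h \<Longrightarrow> 0 \<le> l \<and> h \<le> k"
  shows "computes w (do {
      nonempty \<leftarrow> leq (Reg l) (Reg h);
      if nonempty then do {
        t \<leftarrow> ret (if low_end then Reg l else Reg h);
        p \<leftarrow> mul (Reg s1) t; kt \<leftarrow> sub (Reg k) t; q \<leftarrow> mul (Reg s2) kt;
        valid \<leftarrow> both (has_dist (Reg k) (p, q) (Reg 0, Reg 0)) (has_dist (Reg k) (p, q) (Reg c1, Reg c2));
        if valid then do {
          S \<leftarrow> add_point (Reg a1, Reg a2) (p, q); NS \<leftarrow> gmod_ram (Reg k) S; ret (Some NS) }
        else ret None }
      else ret None })
    (map_option reg_point (parallel_result (a1, a2) (c1, c2) (Some (l, h)) low_end s1 s2)) 130"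
proof -
  define t where "t = (if low_end then l else h)"
  define p where "p = s1 * t"
  define q where "q = s2 * (k - t)"
  \<comment> \<open>The instruction rules match operands of the form \<open>Reg _\<close>, so the
    choice of endpoint is moved inside the constructor.\<close>
  have regs: "(if low_end then Reg l else Reg h) = Reg t"
    by (simp add: t_def)
  have result: "map_option reg_point (parallel_result (a1, a2) (c1, c2) (Some (l, h)) low_end s1 s2) =
    (if l \<le> h then
       if gdist k (p, q) (0, 0) = k \<and> gdist k (p, q) (c1, c2) = k
       then Some (reg_point (gmod k (a1 + p, a2 + q))) else None
     else None)"
    by (simp add: parallel_result_def Let_def p_def q_def t_def zero_prod_def)
  \<comment> \<open>These bounds hold in the branch where the program does its arithmetic: a
    nonempty interval lies between 0 and \<open>k\<close>.\<close>
  have bounds: "\<bar>t\<bar> \<le> k" "\<bar>k - t\<bar> \<le> k" "\<bar>p\<bar> \<le> k" "\<bar>q\<bar> \<le> k" if "l \<le> h"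
  proof -
    show t: "\<bar>t\<bar> \<le> k" "\<bar>k - t\<bar> \<le> k"
      using interval[OF that] that by (auto simp: t_def)
    then show "\<bar>p\<bar> \<le> k" "\<bar>q\<bar> \<le> k"
      using abs_bounds(3)[OF signs(1) t(1)] abs_bounds(3)[OF signs(2) t(2)]
      by (simp_all add: p_def q_def)
  qed
  have valid: "computes w (both (has_dist (Reg k) (Reg p, Reg q) (Reg 0, Reg 0))
      (has_dist (Reg k) (Reg p, Reg q) (Reg c1, Reg c2)))
    (gdist k (p, q) (0, 0) = k \<and> gdist k (p, q) (c1, c2) = k) (41 + 41)" if "l \<le> h"
    by (rule computes_both; rule computes_has_dist) (use bounds[OF that] disc in auto)
  have new_source: "computes w (do { S \<leftarrow> add_point (Reg a1, Reg a2) (Reg p, Reg q);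
      NS \<leftarrow> gmod_ram (Reg k) S; ret (Some NS) })
    (Some (reg_point (gmod k (a1 + p, a2 + q)))) (2 + (31 + 0))" if "l \<le> h"
    by (rule computes_call computes_bind[OF computes_gmod, rotated 2] computes_ret refl)+
      (use bounds[OF that] disc word_linear k_pos in auto)
  show ?thesis
    unfolding result regs
    apply (rule computes_mono)
     apply (rule computes_step computes_if)+
          apply (unfold p_def[symmetric] q_def[symmetric])
          apply (rule computes_bind[OF valid] computes_if new_source computes_ret refl | assumption)+
       apply (use bounds word_linear k_pos in \<open>simp; fail\<close>)+
     apply (rule computes_ret refl)+
    apply simp
    done
qed

lemma computes_parallel:
  assumes disc: "\<bar>a1\<bar> \<le> k" "\<bar>a2\<bar> \<le> k" "\<bar>c1\<bar> \<le> k" "\<bar>c2\<bar> \<le> k"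
    and shifted: "\<bar>c'\<bar> \<le> 4 * k" "\<bar>d'\<bar> \<le> 4 * k"
    and signs: "\<bar>s1\<bar> \<le> 1" "\<bar>s2\<bar> \<le> 1"
  shows "computes w (parallel_ram (Reg k) (Reg a1, Reg a2) (Reg c1, Reg c2) (Reg c', Reg d') low_end
      (Reg s1) (Reg s2) (Reg s3) (Reg s4) (Reg M))
    (map_option reg_point (parallel_result (a1, a2) (c1, c2)
      (parallel_interval c' d' s1 s2 s3 s4 M) low_end s1 s2)) 200"
proof -
  have prods: "\<bar>s1 * c'\<bar> \<le> 1 * (4 * k)" "\<bar>s2 * d'\<bar> \<le> 1 * (4 * k)"
    by (rule shifted signs abs_bounds)+
  have interval: "map_option (map_prod Reg Reg) (parallel_interval c' d' s1 s2 s3 s4 M) =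
    (if s3 = s1 \<and> (s4 = s2 \<and> M = k) then Some (Reg (max 0 (s1 * c')), Reg (min k (k - s2 * d')))
     else if s3 = - s1 \<and> (s4 = - s2 \<and> M = - k)
       then Some (Reg (max 0 (k - s2 * d')), Reg (min k (s1 * c')))
     else None)"
    by (simp add: parallel_interval_def)
  have ends: "0 \<le> l \<and> h \<le> k" if "parallel_interval c' d' s1 s2 s3 s4 M = Some (l, h)" for l h
    using that by (auto simp: parallel_interval_def split: if_splits)
  \<comment> \<open>The rest of the program is treated for an abstract \<open>V\<close>, separately
    from the branching that produces the interval.\<close>
  have tail: "computes w (case map_option (map_prod Reg Reg) V of
       None \<Rightarrow> ret None
     | Some (l, h) \<Rightarrow> do {
         nonempty \<leftarrow> leq l h;
         if nonempty then do {
           t \<leftarrow> ret (if low_end then l else h);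
           p \<leftarrow> mul (Reg s1) t; kt \<leftarrow> sub (Reg k) t; q \<leftarrow> mul (Reg s2) kt;
           valid \<leftarrow> both (has_dist (Reg k) (p, q) (Reg 0, Reg 0))
             (has_dist (Reg k) (p, q) (Reg c1, Reg c2));
           if valid then do {
             S \<leftarrow> add_point (Reg a1, Reg a2) (p, q); NS \<leftarrow> gmod_ram (Reg k) S; ret (Some NS) }
           else ret None }
         else ret None })
    (map_option reg_point (parallel_result (a1, a2) (c1, c2) V low_end s1 s2)) 130"
    if V: "V = parallel_interval c' d' s1 s2 s3 s4 M" for V
  proof (cases V)
    case None
    then show ?thesis by (simp add: parallel_result_def computes_def ret_def)
  next
    case (Some lh)
    obtain l h where "lh = (l, h)" by fastforce
    with Some V computes_parallel_tail[OF disc signs ends, of l h low_end] show ?thesis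
      by simp
  qed
  show ?thesis
    unfolding parallel_ram.simps
    apply (rule computes_mono)
     apply (rule computes_step computes_call)+
            apply (rule computes_bind)
             apply (rule computes_both computes_instr)+
            apply (rule computes_bind)
             apply (rule computes_both computes_instr)+
            \<comment> \<open>The intermediate value is given explicitly, in the
              \<open>map_option\<close> form that \<open>tail\<close> expects.\<close>
            apply (rule computes_bind
        [where x = "map_option (map_prod Reg Reg) (parallel_interval c' d' s1 s2 s3 s4 M)"])
             apply (unfold interval)[1]
             apply (rule computes_if computes_bind[OF computes_max] computes_bind[OF computes_min]
        computes_ret refl)+
            apply (rule tail[OF refl])
    using prods signs word_linear k_pos
           apply simp_all
    done
qed

section \<open>A single case and the whole algorithm\<close>

text \<open>A real quotient of integers by \<open>D\<close> is integral iff the remainder vanishes,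
  and then it equals \<open>div\<close>, so real arithmetic disappears. For \<open>D = 0\<close>
  only the grouping of the conditionals differs.\<close>

lemma case_result_eq:
  assumes c': "c' = fst C + fst (lattice_vec k m n)" and d': "d' = snd C + snd (lattice_vec k m n)"
    and M: "M = k + s3 * c' + s4 * d'" and D: "D = s1 * s4 - s2 * s3"
  shows "case_result k A B C low ((m, n), (s1, s2, s3, s4)) =
    (if D = 0 then
       parallel_result A C (parallel_interval c' d' s1 s2 s3 s4 M)
         (low ((m, n), (s1, s2, s3, s4))) s1 s2
     else intersecting_result A B (c', d') (k * s4 - s2 * M) (s1 * M - k * s3) D)"
proof (cases "D = 0")
  case True
  then show ?thesis
    unfolding case_result.simps Let_def c'[symmetric] d'[symmetric] M[symmetric] D[symmetric]
      parallel_result_def parallel_interval_def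
    by (simp only: simp_thms if_True if_False prod.inject conj_assoc)
next
  case False
  define pn where "pn = k * s4 - s2 * M"
  define qn where "qn = s1 * M - k * s3"
  have int: "real_of_int a / real_of_int D \<in> \<int> \<longleftrightarrow> a mod D = 0" for a
    using False by (simp add: of_int_div_of_int_in_Ints_iff mod_eq_0_iff_dvd)
  have quot: "real_of_int a / real_of_int D = real_of_int (a div D)" if "a mod D = 0" for a
    using that by (simp add: real_of_int_div mod_eq_0_iff_dvd)
  have sum: "\<bar>real_of_int x\<bar> + \<bar>real_of_int y\<bar> = real_of_int k \<longleftrightarrow> manhattan (x, y) = k" for x y
    unfolding manhattan_def fst_conv snd_conv
    by (simp only: of_int_abs[symmetric] of_int_add[symmetric] of_int_eq_iff)
  have "case_result k A B C low ((m, n), (s1, s2, s3, s4)) =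
      intersecting_result A B (c', d') pn qn D"
  \<comment> \<open>If both divisions are exact, the floors act on integers; otherwise both sides
    are \<open>None\<close>.\<close>
  proof (cases "pn mod D = 0 \<and> qn mod D = 0")
    case True
    then show ?thesis
      using False
      unfolding case_result.simps Let_def c'[symmetric] d'[symmetric] M[symmetric] D[symmetric]
        pn_def[symmetric] qn_def[symmetric] int
      by (simp only: quot of_int_diff[symmetric] sum floor_of_int simp_thms if_True
          intersecting_result_def Let_def diff_Pair) auto
  next
    case indivisible: False
    then show ?thesis
      using False
      unfolding case_result.simps Let_def c'[symmetric] d'[symmetric] M[symmetric] D[symmetric]
        pn_def[symmetric] qn_def[symmetric] int
      by (auto simp only: intersecting_result_def Let_def simp_thms if_True if_False
          mod_eq_0_iff_dvd split: if_splits)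
  qed
  then show ?thesis
    using False by (simp only: pn_def qn_def if_False)
qed

lemma computes_case:
  assumes A: "A \<in> disc k" and B: "B \<in> disc k" and C: "C \<in> disc k"
    and x: "x \<in> all_cases"
  shows "computes w (case_ram (Reg k) (reg_point A) (reg_point B) (reg_point C) low x)
    (map_option reg_point (case_result k A B C low x)) 300"
proof -
  obtain m n s1 s2 s3 s4 where x_eq: "x = ((m, n), (s1, s2, s3, s4))"
    by (metis prod.exhaust)
  have shifts: "m \<in> {-1, 0, 1}" "n \<in> {-1, 0, 1}"
    and "s1 \<in> {-1, 1}" "s2 \<in> {-1, 1}" "s3 \<in> {-1, 1}" "s4 \<in> {-1, 1}"
    using x unfolding x_eq all_cases_def mem_Times_iff fst_conv snd_conv
    by - (elim conjE, assumption)+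
  then have signs: "\<bar>s1\<bar> \<le> 1" "\<bar>s2\<bar> \<le> 1" "\<bar>s3\<bar> \<le> 1" "\<bar>s4\<bar> \<le> 1"
    by auto
  have mn: "\<bar>m\<bar> \<le> 1" "\<bar>n\<bar> \<le> 1"
    using shifts by auto
  obtain a1 a2 b1 b2 c1 c2 where pts: "A = (a1, a2)" "B = (b1, b2)" "C = (c1, c2)"
    by (metis prod.exhaust)
  have regs: "reg_point A = (Reg a1, Reg a2)" "reg_point B = (Reg b1, Reg b2)"
    "reg_point C = (Reg c1, Reg c2)"
    by (simp_all add: pts reg_point_def)
  have disc: "\<bar>a1\<bar> \<le> k" "\<bar>a2\<bar> \<le> k" "\<bar>b1\<bar> \<le> k" "\<bar>b2\<bar> \<le> k" "\<bar>c1\<bar> \<le> k" "\<bar>c2\<bar> \<le> k"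
    using disc_bounds[OF A] disc_bounds[OF B] disc_bounds[OF C] by (simp_all add: pts)
  define c' where "c' = c1 + fst (lattice_vec k m n)"
  define d' where "d' = c2 + snd (lattice_vec k m n)"
  define M where "M = k + s3 * c' + s4 * d'"
  define D where "D = s1 * s4 - s2 * s3"
  have "\<bar>c'\<bar> \<le> k + (1 * k + 1 * (k + 1))" "\<bar>d'\<bar> \<le> k + (1 * (k + 1) + 1 * k)"
    unfolding c'_def d'_def lattice_vec_def fst_conv snd_conv by (rule disc mn abs_bounds)+
  \<comment> \<open>The bound is \<open>3*k + 1\<close>, at most \<open>4*k\<close> because
    \<open>k\<close> is a positive integer.\<close>
  then have shifted: "\<bar>c'\<bar> \<le> 4 * k" "\<bar>d'\<bar> \<le> 4 * k"
    using k_pos by auto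
  have prods: "\<bar>s3 * c'\<bar> \<le> 1 * (4 * k)" "\<bar>s4 * d'\<bar> \<le> 1 * (4 * k)"
    "\<bar>s1 * s4\<bar> \<le> 1 * 1" "\<bar>s2 * s3\<bar> \<le> 1 * 1"
    by (rule shifted signs abs_bounds)+
  \<comment> \<open>Here \<open>9*k\<close> is \<open>k + 4*k + 4*k\<close>.\<close>
  have M: "\<bar>M\<bar> \<le> 9 * k" and D: "\<bar>D\<bar> \<le> 2"
    using prods k_pos by (auto simp: M_def D_def)
  have result: "case_result k A B C low x =
    (if D = 0 then
       parallel_result (a1, a2) (c1, c2) (parallel_interval c' d' s1 s2 s3 s4 M) (low x) s1 s2
     else intersecting_result (a1, a2) (b1, b2) (c', d') (k * s4 - s2 * M) (s1 * M - k * s3) D)"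
    unfolding x_eq pts[symmetric]
    by (rule case_result_eq) (simp_all add: c'_def d'_def M_def D_def pts)
  have parallel: "computes w (parallel_ram (Reg k) (Reg a1, Reg a2) (Reg c1, Reg c2) (Reg c', Reg d')
      (low x) (Reg s1) (Reg s2) (Reg s3) (Reg s4) (Reg M))
    (map_option reg_point (case_result k A B C low x)) 200" if "D = 0"
    using computes_parallel[OF disc(1,2,5,6) shifted signs(1,2), of "low x" s3 s4 M] that
    unfolding result by (simp only: if_True simp_thms)
  have intersecting: "computes w (intersecting_ram (Reg k) (Reg a1, Reg a2) (Reg b1, Reg b2)
      (Reg c', Reg d') (Reg s1) (Reg s2) (Reg s3) (Reg s4) (Reg M) (Reg D))
    (map_option reg_point (case_result k A B C low x)) 200" if "D \<noteq> 0"
    using computes_intersecting[OF disc(1-4) shifted M signs D that] that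
    unfolding result by (simp only: if_False simp_thms)
  show ?thesis
    unfolding regs x_eq case_ram.simps
    apply (rule computes_mono)
     apply (rule computes_step)+
             apply (rule computes_bind)
              apply (rule computes_lattice)
    using mn apply simp
    using mn apply simp
    apply (rule computes_step computes_call)+
             apply (fold c'_def d'_def, fold M_def D_def, fold x_eq)
             apply (rule computes_if_same)
              apply (rule parallel intersecting, assumption)+
            apply (rule order_le_less_trans, (rule prods shifted M D signs mn abs_bounds)+,
        use word_linear k_pos in linarith)+
    apply simp
    done
qed

text \<open>The setup costs 33, namely 2 for \<open>B - A\<close> and 31 for its reduction; each
  case costs at most 300 and one \<open>tick\<close>.\<close>

lemma select_source_ram_correct:
  assumes A: "A \<in> disc k" and B: "B \<in> disc k" and cs: "set cs \<subseteq> all_cases"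
  shows "\<exists>steps t. select_source_ram low cs (Reg k) (reg_point A) (reg_point B) w =
      Some ((map_option reg_point (select_source low cs k A B), steps), t) \<and>
    length steps \<le> length cs \<and> (\<forall>s \<in> set steps. s \<le> 300) \<and> t \<le> 33 + length cs * 301"
proof -
  define C where "C = gmod k (B - A)"
  obtain a1 a2 b1 b2 where pts: "A = (a1, a2)" "B = (b1, b2)"
    by (metis prod.exhaust)
  have disc: "\<bar>a1\<bar> \<le> k" "\<bar>a2\<bar> \<le> k" "\<bar>b1\<bar> \<le> k" "\<bar>b2\<bar> \<le> k"
    using disc_bounds[OF A] disc_bounds[OF B] by (simp_all add: pts)
  have "computes w (sub_point (reg_point B) (reg_point A)) (Reg (b1 - a1), Reg (b2 - a2)) 2"
    unfolding reg_point_def pts fst_conv snd_conv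
    using disc word_linear k_pos by (intro computes_sub_point) auto
  then obtain t1 where t1: "sub_point (reg_point B) (reg_point A) w =
      Some ((Reg (b1 - a1), Reg (b2 - a2)), t1)" "t1 \<le> 2"
    by (auto simp: computes_def)
  have "computes w (gmod_ram (Reg k) (Reg (b1 - a1), Reg (b2 - a2))) (reg_point C) 31"
    using computes_gmod[of "b1 - a1" "b2 - a2"] disc k_pos by (simp add: C_def pts)
  then obtain t2 where t2: "gmod_ram (Reg k) (Reg (b1 - a1), Reg (b2 - a2)) w =
      Some (reg_point C, t2)" "t2 \<le> 31"
    by (auto simp: computes_def)
  have "C \<in> disc k"
    using gmod_in_disc[OF k_pos] by (simp add: C_def)
  then obtain steps t3 where "search_ram (case_ram (Reg k) (reg_point A) (reg_point B) (reg_point C) low) cs w =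
      Some ((map_option reg_point (first_result (case_result k A B C low) cs), steps), t3)"
    "length steps \<le> length cs" "\<forall>s \<in> set steps. s \<le> 300" "t3 \<le> length cs * (1 + 300)"
    using computes_search[of cs w "case_ram (Reg k) (reg_point A) (reg_point B) (reg_point C) low"
        "\<lambda>x. map_option reg_point (case_result k A B C low x)" 300] computes_case[OF A B] cs
    unfolding first_result_map_option by blast
  then show ?thesis
    using t1 t2 by (auto simp: select_source_ram_def select_source_def ram_bind_def C_def)
qed

end

text \<open>The constants are chosen before all inputs, the order of the cases and the endpoint
  choices, which expresses constant time. Fixing the value as that of \<open>select_source\<close>
  ties the cost to the specified algorithm.\<close>

theorem mainTheorem3:
  shows "\<exists>b c T :: nat. \<forall>(k :: int) (A :: point) (B :: point) (cs :: case_id list) (low :: case_id \<Rightarrow> bool) (w :: nat).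
    0 < k \<longrightarrow> A \<in> disc k \<longrightarrow> B \<in> disc k \<longrightarrow> A \<noteq> B \<longrightarrow>
    distinct cs \<longrightarrow> set cs = all_cases \<longrightarrow>
    2 ^ b * num_nodes k \<le> 2 ^ w \<longrightarrow>
    (\<exists>(steps :: nat list) (t :: nat).
       select_source_ram low cs (Reg k) (reg_point A) (reg_point B) w =
         Some ((map_option reg_point (select_source low cs k A B), steps), t) \<and>
       length steps \<le> 9 * 16 \<and>
       (\<forall>s \<in> set steps. s \<le> c) \<and>
       t \<le> T)"
\<comment> \<open>The witnesses are the slack of the word size, the bound for one case, and the
  setup cost plus 144 iterations.\<close>
proof (rule exI[of _ 12], rule exI[of _ 300], rule exI[of _ "33 + 9 * 16 * 301"], intro allI impI)
  fix k :: int and A B :: point and cs :: "case_id list" and low :: "case_id \<Rightarrow> bool" and w :: nat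
  assume "0 < k" and A: "A \<in> disc k" and B: "B \<in> disc k" and "A \<noteq> B"
    and "distinct cs" and cs: "set cs = all_cases"
    and "2 ^ 12 * num_nodes k \<le> 2 ^ w"
  then interpret network_ram k w
    by unfold_locales
  have "card all_cases = 9 * 16"
    by (simp add: all_cases_def)
  \<comment> \<open>A duplicate-free enumeration of \<open>all_cases\<close> has as many entries as
    the set has elements.\<close>
  then have "length cs = 9 * 16"
    using \<open>distinct cs\<close> cs by (metis distinct_card)
  then show "\<exists>steps t. select_source_ram low cs (Reg k) (reg_point A) (reg_point B) w =
      Some ((map_option reg_point (select_source low cs k A B), steps), t) \<and>
    length steps \<le> 9 * 16 \<and> (\<forall>s \<in> set steps. s \<le> 300) \<and> t \<le> 33 + 9 * 16 * 301"
    using select_source_ram_correct[OF A B, of cs low] cs by simp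
qed

end
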